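(* For every integer $n\ge 1$ and all integers $r,k\in\mathbb{Z}$, $$\begin{aligned} s_{n}^{(r,k)}(x)={}&-r\,s_{n-1}^{(r,k)}(x)+r\sum_{l=0}^{n-1}\frac{\binom{n-1}{l}}{(n+1-l)(n-l)}\,s_{l}^{(r+1,k)}(x)\\ &+\sum_{l=0}^{n-1}\left\{(-1)^{n-1-l}\binom{n-1}{l}\sum_{m=0}^{n-1-l}(-1)^{m}\frac{(m+1)!}{(m+2)^{k}}S_{2}(n-1-l,m)\right\}\mathbb{B}_{l}^{(r)}(x-1)\\ &+x\,s_{n-1}^{(r,k)}(x) \end{aligned}$$ as polynomials in $x$.
   Context: For $k\in\mathbb{Z}$, $Li_k(x)=\sum_{n=1}^{\infty}\frac{x^n}{n^k}$ is the polylogarithm, regarded as a formal power series; $\frac{Li_k(1-e^{-t})}{1-e^{-t}}$ is then a formal power series in $t$ over $\mathbb{C}$. For $r\in\mathbb{Z}$, the Bernoulli polynomials of order $r$, $\mathbb{B}_n^{(r)}(x)$, are defined by $\left(\frac{t}{e^t-1}\right)^r e^{xt}=\sum_{n\ge0}\mathbb{B}_n^{(r)}(x)\frac{t^n}{n!}$. For $r,k\in\mathbb{Z}$, the higher-order Bernoulli and poly-Bernoulli mixed type polynomials $s_n^{(r,k)}(x)$ are defined by $\left(\frac{t}{e^t-1}\right)^r\frac{Li_k(1-e^{-t})}{1-e^{-t}}e^{xt}=\sum_{n\ge0}s_n^{(r,k)}(x)\frac{t^n}{n!}$. $S_2(n,m)$ denotes the Stirling number of the second kind (with $S_2(0,0)=1$).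 *)

theory Defs
  imports
    Complex_Main
    "HOL-Computational_Algebra.Formal_Power_Series"
    "HOL-Computational_Algebra.Polynomial"
    "HOL-Combinatorics.Stirling"
begin

text \<open>
  Power series in the variable \<open>t\<close> are elements of \<^typ>\<open>complex fps\<close>. A power series
  whose coefficients depend polynomially on \<open>x\<close> is an element of \<^typ>\<open>complex poly fps\<close>.
\<close>

definition polylog_fps :: "int \<Rightarrow> complex fps" where
  "polylog_fps k = Abs_fps (\<lambda>n. if n = 0 then 0 else 1 / of_nat n powi k)"

text \<open>
  In the next two definitions the denominator has no constant term. Division is the one
  on \<^typ>\<open>complex fps\<close>, which cancels powers of \<open>t\<close>; it is exact here because the
  numerator has no constant term either (\<open>bernoulli_fps_mult\<close> and
  \<open>poly_bernoulli_fps_mult\<close> below).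
\<close>

definition bernoulli_fps :: "complex fps" where
  "bernoulli_fps = fps_X / (fps_exp 1 - 1)"

definition poly_bernoulli_fps :: "int \<Rightarrow> complex fps" where
  "poly_bernoulli_fps k =
     (polylog_fps k oo (1 - fps_exp (-1))) / (1 - fps_exp (-1))"

lemma bernoulli_fps_mult: "bernoulli_fps * (fps_exp 1 - 1) = fps_X"
proof -
  have nz: "(fps_exp 1 - 1 :: complex fps) \<noteq> 0"
  proof
    assume "(fps_exp 1 - 1 :: complex fps) = 0"
    hence "fps_nth (fps_exp 1 - 1 :: complex fps) 1 = fps_nth 0 1" by simp
    thus False by simp
  qed
  have "subdegree (fps_exp 1 - 1 :: complex fps) \<le> 1"
    by (rule subdegree_leI) simp
  hence "(fps_exp 1 - 1 :: complex fps) dvd fps_X"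
    using nz by (simp add: fps_dvd_iff)
  thus ?thesis by (simp add: bernoulli_fps_def)
qed

lemma poly_bernoulli_fps_mult:
  "poly_bernoulli_fps k * (1 - fps_exp (-1)) = polylog_fps k oo (1 - fps_exp (-1))"
proof -
  let ?d = "1 - fps_exp (-1) :: complex fps"
  have nz: "?d \<noteq> 0"
  proof
    assume "?d = 0"
    hence "fps_nth ?d 1 = fps_nth 0 1" by simp
    thus False by simp
  qed
  have le: "subdegree ?d \<le> 1"
    by (rule subdegree_leI) simp
  have "?d dvd (polylog_fps k oo ?d)"
  proof (cases "polylog_fps k oo ?d = 0")
    case False
    have "fps_nth (polylog_fps k oo ?d) 0 = 0"
      by (simp add: polylog_fps_def)
    hence "subdegree (polylog_fps k oo ?d) \<ge> 1"
      using False by (metis One_nat_def Suc_leI gr0I nth_subdegree_nonzero)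
    hence "subdegree ?d \<le> subdegree (polylog_fps k oo ?d)"
      using le by (rule le_trans[rotated])
    thus ?thesis using fps_dvd_iff[OF nz False] by blast
  qed simp
  thus ?thesis unfolding poly_bernoulli_fps_def by (rule dvd_div_mult_self)
qed

definition fps_lift_poly :: "complex fps \<Rightarrow> complex poly fps" where
  "fps_lift_poly F = Abs_fps (\<lambda>n. [:fps_nth F n:])"

text \<open>The series \<open>exp (x t)\<close>, with \<open>x\<close> the polynomial variable.\<close>

definition fps_exp_xt :: "complex poly fps" where
  "fps_exp_xt = Abs_fps (\<lambda>n. monom (1 / fact n) n)"

text \<open>
  The polynomials are \<open>n!\<close> times the coefficient of \<open>t\<^sup>n\<close> in their generating functions; the
  integer power of \<^const>\<open>bernoulli_fps\<close> makes sense for a negative exponent because its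
  constant term is 1.
\<close>

definition bernoulli_poly :: "int \<Rightarrow> nat \<Rightarrow> complex poly" where
  "bernoulli_poly r n =
     smult (fact n) (fps_nth (fps_lift_poly (bernoulli_fps powi r) * fps_exp_xt) n)"

definition mixed_poly :: "int \<Rightarrow> int \<Rightarrow> nat \<Rightarrow> complex poly" where
  "mixed_poly r k n =
     smult (fact n)
       (fps_nth (fps_lift_poly (bernoulli_fps powi r * poly_bernoulli_fps k) * fps_exp_xt) n)"

lemma bernoulli_fps_nth_0: "fps_nth bernoulli_fps 0 = 1"
proof -
  have "fps_nth (bernoulli_fps * (fps_exp 1 - 1)) 1 = 1"
    by (simp add: bernoulli_fps_mult)
  thus ?thesis by (simp add: fps_mult_nth)
qed

text \<open>Evaluating at a number \<open>x\<close> gives the generating functions over \<^typ>\<open>complex\<close>.\<close>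

lemma poly_lift_mult_exp_xt:
  "Abs_fps (\<lambda>n. poly (smult (fact n) (fps_nth (fps_lift_poly F * fps_exp_xt) n)) x / fact n)
     = F * fps_exp x"
proof (rule fps_ext)
  fix n
  have "fps_nth (Abs_fps (\<lambda>n. poly (smult (fact n)
          (fps_nth (fps_lift_poly F * fps_exp_xt) n)) x / fact n)) n
        = poly (fps_nth (fps_lift_poly F * fps_exp_xt) n) x"
    by simp
  also have "\<dots> = (\<Sum>i = 0..n. fps_nth F i * fps_nth (fps_exp x) (n - i))"
    by (simp add: fps_mult_nth fps_lift_poly_def fps_exp_xt_def poly_sum poly_monom)
  also have "\<dots> = fps_nth (F * fps_exp x) n"
    by (simp only: fps_mult_nth)
  finally show "fps_nth (Abs_fps (\<lambda>n. poly (smult (fact n)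
          (fps_nth (fps_lift_poly F * fps_exp_xt) n)) x / fact n)) n
        = fps_nth (F * fps_exp x) n" .
qed

lemma bernoulli_poly_egf:
  "Abs_fps (\<lambda>n. poly (bernoulli_poly r n) x / fact n) = bernoulli_fps powi r * fps_exp x"
  unfolding bernoulli_poly_def by (rule poly_lift_mult_exp_xt)

lemma mixed_poly_egf:
  "Abs_fps (\<lambda>n. poly (mixed_poly r k n) x / fact n)
     = bernoulli_fps powi r * poly_bernoulli_fps k * fps_exp x"
  unfolding mixed_poly_def by (rule poly_lift_mult_exp_xt)

end

theory Submission
  imports Defs
begin

text \<open>
  Write \<open>B = t/(e\<^sup>t - 1)\<close>, let \<open>P\<close> be the poly-Bernoulli series, and differentiate
  \<open>B\<^sup>r P e\<^bsup>xt\<^esup>\<close> with respect to \<open>t\<close>. The three factors contribute the terms of the recurrence: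
  \<open>B'/B = B \<cdot> (e\<^sup>t - 1 - t)/t\<^sup>2 - 1\<close>, where the division by \<open>t\<^sup>2\<close> shifts the exponential
  series to \<open>\<Sum>j. t\<^sup>j/(j + 2)!\<close>; \<open>P\<close> is a composition with \<open>1 - e\<^bsup>-t\<^esup>\<close>, so its derivative is
  \<open>e\<^bsup>-t\<^esup>\<close> times a series in the powers of \<open>1 - e\<^bsup>-t\<^esup>\<close>, whose coefficients are Stirling
  numbers, and the factor \<open>e\<^bsup>-t\<^esup>\<close> shifts \<open>x\<close> to \<open>x - 1\<close>; finally \<open>e\<^bsup>xt\<^esup>\<close> gives \<open>x\<close>.
\<close>

text \<open>Power series do not form a field: negative powers are powers of
  \<open>inverse F\<close>, and the nonzero constant term is what gives
  \<open>inverse F * F = 1\<close>.\<close>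

lemma fps_power_int_add_1:
  fixes F :: "'a :: field fps"
  assumes "fps_nth F 0 \<noteq> 0"
  shows "F powi (r + 1) = F powi r * F"
proof (cases "r \<ge> 0")
  case True
  then show ?thesis
    by (simp add: power_int_def nat_add_distrib mult.commute)
next
  case False
  then obtain m where r: "r = - int (Suc m)"
    by (cases r) auto
  have "inverse F * F = 1"
    using assms by (rule inverse_mult_eq_1)
  then show ?thesis
    by (cases "m = 0") (simp_all add: r power_int_def nat_add_distrib mult_ac)
qed

text \<open>Multiplying the power rule by \<open>F\<close> keeps the exponent \<open>r\<close> on
  both sides, so the product rule drives an induction from 0 in both directions.\<close>

lemma fps_deriv_power_int:
  fixes F :: "'a :: field fps"
  assumes "fps_nth F 0 \<noteq> 0"
  shows "F * fps_deriv (F powi r) = of_int r * fps_deriv F * F powi r"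
proof (induction r rule: int_induct[where k = 0])
  case base
  then show ?case by simp
next
  case (step1 i)
  have "F * fps_deriv (F powi i * F) =
      (F * fps_deriv (F powi i)) * F + F * F powi i * fps_deriv F"
    by (simp add: algebra_simps)
  then show ?case
    unfolding step1(2) fps_power_int_add_1[OF assms] by (simp add: algebra_simps)
next
  case (step2 i)
  have F: "F \<noteq> 0" using assms by auto
  have eq: "F powi i = F powi (i - 1) * F"
    using fps_power_int_add_1[OF assms, of "i - 1"] by simp
  \<comment> \<open>The product rule applied in the hypothesis for \<open>i\<close> leaves a surplus
    factor \<open>F\<close>, cancelled because there are no zero divisors.\<close>
  have "F * (F * fps_deriv (F powi (i - 1))) = F * (of_int (i - 1) * fps_deriv F * F powi (i - 1))"
    using step2(2) unfolding eq by (simp add: algebra_simps)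
  then show ?case using F by simp
qed

text \<open>For \<open>F = fps_exp c - 1\<close>, F' = c (F + 1), hence (F^(m+1))' = c (m+1)
  (F^(m+1) + F^m). On coefficients this is the Stirling recurrence.\<close>

lemma fps_exp_minus_one_power_nth:
  fixes c :: "'a :: field_char_0"
  shows "fps_nth ((fps_exp c - 1) ^ m) j = fact m * of_nat (Stirling j m) * c ^ j / fact j"
proof (induction j arbitrary: m)
  case 0
  show ?case by (cases m) (simp_all add: fps_nth_power_0)
next
  case (Suc j)
  show ?case
  proof (cases m)
    case 0
    then show ?thesis by simp
  next
    case (Suc m')
    define F where "F = fps_exp c - 1"
    have "fps_deriv F = fps_const c * (F + 1)"
      by (simp add: F_def)
    then have "fps_deriv (F ^ Suc m') = fps_const (of_nat (Suc m')) * (fps_const c * (F + 1)) * F ^ m'"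
      by (simp only: fps_deriv_power diff_Suc_1)
    also have "\<dots> = fps_const (c * of_nat (Suc m')) * (F ^ Suc m' + F ^ m')"
      by (simp only: power_Suc flip: fps_const_mult)
        (simp add: algebra_simps del: of_nat_Suc fps_const_mult)
    finally have "of_nat (Suc j) * fps_nth (F ^ Suc m') (Suc j) =
        c * of_nat (Suc m') * (fps_nth (F ^ Suc m') j + fps_nth (F ^ m') j)"
      by (metis fps_deriv_nth fps_mult_left_const_nth fps_add_nth Suc_eq_plus1)
    then have "fps_nth (F ^ Suc m') (Suc j) =
        c * of_nat (Suc m') * (fps_nth (F ^ Suc m') j + fps_nth (F ^ m') j) / of_nat (Suc j)"
      by (simp add: eq_divide_eq mult.commute del: of_nat_Suc power_Suc)
    also have "\<dots> = fact (Suc m') * of_nat (Stirling (Suc j) (Suc m')) * c ^ Suc j / fact (Suc j)"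
      unfolding F_def Suc.IH
      by (simp only: Stirling.simps of_nat_add of_nat_mult fact_Suc power_Suc)
        (simp add: field_simps del: of_nat_Suc)
    finally show ?thesis
      by (simp only: Suc F_def)
  qed
qed

text \<open>Differentiating B (e^t - 1) = t gives B' (e^t - 1) = 1 - B e^t. Replacing 1 by B (1 + t
  E), with E the displayed series, makes the right side a multiple of B (e^t - 1).\<close>

lemma deriv_bernoulli_fps:
  "fps_deriv bernoulli_fps = bernoulli_fps * (bernoulli_fps * Abs_fps (\<lambda>j. 1 / fact (j + 2)) - 1)"
proof -
  define e :: "complex fps" where "e = fps_exp 1"
  define E :: "complex fps" where "E = Abs_fps (\<lambda>j. 1 / fact (j + 2))"
  define B where "B = bernoulli_fps"
  have B: "B * (e - 1) = fps_X"
    unfolding B_def e_def by (rule bernoulli_fps_mult)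
  have e: "e - 1 = fps_X * (1 + fps_X * E)"
  proof (rule fps_ext)
    fix n :: nat
    have "n = 0 \<or> n = 1 \<or> (\<exists>m. n = m + 2)"
      by presburger
    then show "fps_nth (e - 1) n = fps_nth (fps_X * (1 + fps_X * E)) n"
      by (auto simp: e_def E_def)
  qed
  have "fps_X * (B * (1 + fps_X * E)) = fps_X * 1"
    using B unfolding e by (simp add: algebra_simps)
  then have one: "B * (1 + fps_X * E) = 1"
    by (metis mult_cancel_left fps_X_neq_zero)
  have "fps_deriv (B * (e - 1)) = 1"
    unfolding B by simp
  then have "fps_deriv B * (e - 1) = 1 - B * e"
    by (simp add: e_def algebra_simps)
  also have "\<dots> = B * (1 + fps_X * E) - B * e"
    by (simp only: one)
  \<comment> \<open>The remaining \<open>fps_X\<close> is written back as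
    \<open>B * (e - 1)\<close>.\<close>
  also have "\<dots> = B * (B * E - 1) * (e - 1)"
    by (simp add: algebra_simps flip: B)
  finally have "fps_deriv B * (e - 1) = B * (B * E - 1) * (e - 1)" .
  moreover have "e - 1 \<noteq> 0"
    using B by auto
  ultimately show ?thesis
    unfolding B_def E_def by simp
qed

text \<open>Li_k(t) is t times the displayed outer series, so the division by 1 - e^(-t) disappears
  and the chain rule becomes available.\<close>

lemma poly_bernoulli_fps_eq_compose:
  "poly_bernoulli_fps k = Abs_fps (\<lambda>m. 1 / of_nat (m + 1) powi k) oo (1 - fps_exp (-1))"
proof -
  define u :: "complex fps" where "u = 1 - fps_exp (-1)"
  define Q :: "complex fps" where "Q = Abs_fps (\<lambda>m. 1 / of_nat (m + 1) powi k)"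
  have u0: "fps_nth u 0 = 0" by (simp add: u_def)
  have "fps_nth u 1 \<noteq> 0" by (simp add: u_def)
  then have u: "u \<noteq> 0" by auto
  have "polylog_fps k = fps_X * Q"
    by (rule fps_ext) (simp add: polylog_fps_def Q_def)
  then have "poly_bernoulli_fps k * u = (Q oo u) * u"
    using poly_bernoulli_fps_mult[of k] u0
    by (simp add: fps_compose_mult_distrib mult.commute flip: u_def)
  then show ?thesis
    using u by (simp add: u_def Q_def)
qed

lemma deriv_poly_bernoulli_fps:
  "fps_deriv (poly_bernoulli_fps k) =
     Abs_fps (\<lambda>j. (-1) ^ j * (\<Sum>m = 0..j. (-1) ^ m * (fact (m + 1) / of_nat (m + 2) powi k)
                   * of_nat (Stirling j m)) / fact j) * fps_exp (-1)"
proof -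
  define u :: "complex fps" where "u = 1 - fps_exp (-1)"
  define Q :: "complex fps" where "Q = Abs_fps (\<lambda>m. 1 / of_nat (m + 1) powi k)"
  \<comment> \<open>The sign (-1)^m comes from u = -(e^(-t) - 1), the sign (-1)^j from the Stirling
    series at c = -1.\<close>
  have u: "fps_nth (u ^ m) j = (-1) ^ m * (fact m * of_nat (Stirling j m) * (-1) ^ j / fact j)"
    for m j
  proof -
    have "u ^ m = fps_const ((-1) ^ m) * (fps_exp (-1) - 1) ^ m"
      unfolding u_def by (metis fps_const_power fps_const_neg fps_const_1_eq_1 minus_diff_eq mult_minus1
          power_mult_distrib)
    then show ?thesis
      by (simp add: fps_exp_minus_one_power_nth)
  qed
  \<comment> \<open>The coefficient (m + 1)/(m + 2)^k of Q' turns the m! of \<open>u ^ m\<close>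
    into (m + 1)!.\<close>
  have "fps_nth (fps_deriv Q oo u) j =
      (-1) ^ j * (\<Sum>m = 0..j. (-1) ^ m * (fact (m + 1) / of_nat (m + 2) powi k)
                   * of_nat (Stirling j m)) / fact j" for j
    unfolding fps_compose_nth u sum_distrib_left sum_divide_distrib
    by (rule sum.cong) (simp_all add: Q_def algebra_simps)
  then have "fps_deriv Q oo u = Abs_fps (\<lambda>j. (-1) ^ j * (\<Sum>m = 0..j. (-1) ^ m *
      (fact (m + 1) / of_nat (m + 2) powi k) * of_nat (Stirling j m)) / fact j)"
    by (intro fps_ext) simp
  moreover have "fps_deriv (Q oo u) = (fps_deriv Q oo u) * fps_exp (-1)"
    by (subst fps_compose_deriv) (simp_all add: u_def flip: fps_const_neg)
  ultimately show ?thesis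
    by (simp add: poly_bernoulli_fps_eq_compose u_def Q_def)
qed

text \<open>In B'/B = B E - 1 the extra factor B raises the order to \<open>r + 1\<close>, and the
  -1 yields the term with -r.\<close>

lemma deriv_mixed_fps:
  fixes x :: complex and k :: int
  defines "M \<equiv> \<lambda>r. bernoulli_fps powi r * poly_bernoulli_fps k * fps_exp x"
  shows "fps_deriv (M r) =
      - (of_int r * M r) + of_int r * (M (r + 1) * Abs_fps (\<lambda>j. 1 / fact (j + 2)))
      + bernoulli_fps powi r * fps_deriv (poly_bernoulli_fps k) * fps_exp x
      + fps_const x * M r"
proof -
  define E :: "complex fps" where "E = Abs_fps (\<lambda>j. 1 / fact (j + 2))"
  define B where "B = bernoulli_fps"
  have B0: "fps_nth B 0 \<noteq> 0" by (simp add: B_def bernoulli_fps_nth_0)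
  then have "B \<noteq> 0" by auto
  moreover have "B * fps_deriv (B powi r) = B * (of_int r * (B * E - 1) * B powi r)"
    using fps_deriv_power_int[OF B0, of r] deriv_bernoulli_fps
    by (simp add: B_def E_def algebra_simps)
  ultimately have deriv: "fps_deriv (B powi r) = of_int r * (B * E - 1) * B powi r"
    by simp
  show ?thesis
    unfolding M_def B_def[symmetric] E_def[symmetric] fps_power_int_add_1[OF B0]
    by (simp add: deriv algebra_simps)
qed

theorem theorem4:
  fixes n :: nat and r k :: int
  assumes "n \<ge> 1"
  shows "mixed_poly r k n =
      - (of_int r * mixed_poly r k (n - 1))
      + of_int r * (\<Sum>l = 0..n - 1.
          smult (of_nat ((n - 1) choose l) / (of_nat (n + 1 - l) * of_nat (n - l)))
            (mixed_poly (r + 1) k l))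
      + (\<Sum>l = 0..n - 1.
          smult ((-1) ^ (n - 1 - l) * of_nat ((n - 1) choose l) *
              (\<Sum>m = 0..n - 1 - l.
                 (-1) ^ m * (fact (m + 1) / of_nat (m + 2) powi k)
                   * of_nat (Stirling (n - 1 - l) m)))
            (pcompose (bernoulli_poly r l) [:-1, 1:]))
      + [:0, 1:] * mixed_poly r k (n - 1)"
proof (rule poly_ext)
  fix x :: complex
  obtain N where n: "n = Suc N"
    using assms by (cases n) auto
  define M where "M = (\<lambda>r. bernoulli_fps powi r * poly_bernoulli_fps k * fps_exp x)"
  define E :: "complex fps" where "E = Abs_fps (\<lambda>j. 1 / fact (j + 2))"
  define c :: "nat \<Rightarrow> complex" where "c j = (\<Sum>m = 0..j. (-1) ^ m *
    (fact (m + 1) / of_nat (m + 2) powi k) * of_nat (Stirling j m))" for j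
  define D where "D = Abs_fps (\<lambda>j. (-1) ^ j * c j / fact j)"
  define R where "R = bernoulli_fps powi r * fps_exp (x - 1)"
  have M: "fps_nth (M r') l = poly (mixed_poly r' k l) x / fact l" for r' l
    by (simp add: M_def flip: mixed_poly_egf)
  have R: "fps_nth R l = poly (bernoulli_poly r l) (x - 1) / fact l" for l
    by (simp add: R_def flip: bernoulli_poly_egf)
  have binom: "fact N / (fact l * fact (N - l)) = (of_nat (N choose l) :: complex)"
    if "l \<le> N" for l
    using that by (simp add: binomial_fact)
  \<comment> \<open>The factor e^(-t) from the chain rule merges with e^(xt), which gives
    \<open>R\<close> its argument \<open>x - 1\<close>.\<close>
  have "fps_deriv (M r) = - (of_int r * M r) + of_int r * (M (r + 1) * E) + R * D + fps_const x * M r"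
    unfolding M_def E_def deriv_mixed_fps deriv_poly_bernoulli_fps R_def D_def c_def
    by (simp add: mult_ac fps_exp_add_mult diff_conv_add_uminus del: add_uminus_conv_diff)
  \<comment> \<open>Differentiation shifts the index: N! times coefficient N of the derivative is n!
    times coefficient n of \<open>M r\<close>.\<close>
  then have "fact N * fps_nth (fps_deriv (M r)) N = fact N *
      fps_nth (- (of_int r * M r) + of_int r * (M (r + 1) * E) + R * D + fps_const x * M r) N"
    by simp
  moreover have "fps_nth (of_int r * F) N = of_int r * fps_nth F N" for F :: "complex fps"
    by (simp flip: fps_of_int)
  ultimately have "fact N * (of_nat (Suc N) * fps_nth (M r) (Suc N)) =
      - (of_int r * (fact N * fps_nth (M r) N)) + of_int r * (fact N * fps_nth (M (r + 1) * E) N)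
      + fact N * fps_nth (R * D) N + x * (fact N * fps_nth (M r) N)"
    by (simp only: fps_deriv_nth fps_add_nth fps_neg_nth fps_mult_left_const_nth Suc_eq_plus1)
      (simp add: algebra_simps)
  moreover have "fact N * (of_nat (Suc N) * fps_nth (M r) (Suc N)) = poly (mixed_poly r k n) x"
    unfolding M n by (simp add: field_simps del: of_nat_Suc)
  moreover have "fact N * fps_nth (M r) N = poly (mixed_poly r k N) x"
    unfolding M by simp
  moreover have "fact N * fps_nth (M (r + 1) * E) N =
      (\<Sum>l = 0..N. of_nat (N choose l) / (of_nat (n + 1 - l) * of_nat (n - l))
        * poly (mixed_poly (r + 1) k l) x)"
    unfolding fps_mult_nth sum_distrib_left
  proof (rule sum.cong)
    fix l assume "l \<in> {0..N}"
    then have l: "l \<le> N" by simp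
    \<comment> \<open>With j = N - l, (j + 2)! = (j + 2) (j + 1) j!: the first two factors form the
      denominator, and j! completes the binomial coefficient.\<close>
    have "n + 1 - l = Suc (Suc (N - l))" "n - l = Suc (N - l)"
      using l by (auto simp: n)
    then show "fact N * (fps_nth (M (r + 1)) l * fps_nth E (N - l)) =
      of_nat (N choose l) / (of_nat (n + 1 - l) * of_nat (n - l)) * poly (mixed_poly (r + 1) k l) x"
      by (simp add: M E_def mult_ac flip: binom[OF l] del: of_nat_Suc)
  qed simp
  moreover have "fact N * fps_nth (R * D) N =
      (\<Sum>l = 0..N. (-1) ^ (N - l) * of_nat (N choose l) * c (N - l)
        * poly (bernoulli_poly r l) (x - 1))"
    unfolding fps_mult_nth sum_distrib_left
  proof (rule sum.cong)
    fix l assume "l \<in> {0..N}"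
    then have l: "l \<le> N" by simp
    show "fact N * (fps_nth R l * fps_nth D (N - l)) =
      (-1) ^ (N - l) * of_nat (N choose l) * c (N - l) * poly (bernoulli_poly r l) (x - 1)"
      by (simp add: R D_def mult_ac flip: binom[OF l])
  qed simp
  moreover have "poly (of_int r) x = of_int r"
    by (simp add: of_int_poly)
  ultimately show "poly (mixed_poly r k n) x = poly (
      - (of_int r * mixed_poly r k (n - 1))
      + of_int r * (\<Sum>l = 0..n - 1.
          smult (of_nat ((n - 1) choose l) / (of_nat (n + 1 - l) * of_nat (n - l)))
            (mixed_poly (r + 1) k l))
      + (\<Sum>l = 0..n - 1.
          smult ((-1) ^ (n - 1 - l) * of_nat ((n - 1) choose l) *
              (\<Sum>m = 0..n - 1 - l.
                 (-1) ^ m * (fact (m + 1) / of_nat (m + 2) powi k)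
                   * of_nat (Stirling (n - 1 - l) m)))
            (pcompose (bernoulli_poly r l) [:-1, 1:]))
      + [:0, 1:] * mixed_poly r k (n - 1)) x"
    by (simp add: n poly_sum poly_pcompose c_def)
qed

end
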